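(* For real $\nu$ let $I_\nu$ denote the modified Bessel function of the first kind, and define $\Phi_\nu:(0,\infty)\to(0,\infty)$ by $$\Phi_{\nu}(x)=e^{-x}x^{-\nu}\left[I_{\nu}(x)+I_{\nu+1}(x)\right].$$ Then the following hold: (a) $\Phi_\nu$ is completely monotonic on $(0,\infty)$ for all $\nu\ge -\tfrac12$; (b) $\Phi_\nu$ is log-convex and geometrically concave on $(0,\infty)$ for all $\nu\ge-\tfrac12$; (c) for every $x>0$, the map $\nu\mapsto\Phi_\nu(x)$ is decreasing on $[0,\infty)$; (d) $x\mapsto x^{\nu+\frac12}\Phi_\nu(x)$ is increasing on $(0,\infty)$ for all $\nu\ge-\tfrac12$; (e) $x\mapsto \left(x+\frac{\nu}{2}\right)^{\nu+\frac12}\Phi_\nu(x)$ is increasing on $(0,\infty)$ for all $\nu\ge-\tfrac12$; (f) $x\mapsto \left(x+\frac{\nu}{2}+\frac14\right)^{\nu+\frac12}\Phi_\nu(x)$ is increasing on $(0,\infty)$ for all $\nu\ge-\tfrac12$; (g) for all $\nu>-\tfrac12$ and $x>0$, $$\frac{\left(\nu+\frac{1}{2}\right)^{\nu+\frac{1}{2}}}{2^{2\nu+\frac{1}{2}}\Gamma(\nu+1)\left(x+\frac{\nu}{2}+\frac{1}{4}\right)^{\nu+\frac{1}{2}}}<\Phi_{\nu}(x)<\sqrt{\frac{2}{\pi}}\cdot\frac{1}{\left(x+\frac{\nu}{2}+\frac{1}{4}\right)^{\nu+\frac{1}{2}}}.$$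
   Context: A function $f:(0,\infty)\to\mathbb{R}$ is completely monotonic if it has derivatives of all orders and $(-1)^m f^{(m)}(x)\ge 0$ for all $x>0$ and $m\in\{0,1,2,\dots\}$. A positive function $g$ is log-convex if $\ln g$ is convex. A positive function $h$ on $(0,\infty)$ is geometrically concave if $h(x^\lambda y^{1-\lambda})\ge [h(x)]^\lambda[h(y)]^{1-\lambda}$ for all $x,y>0$, $\lambda\in[0,1]$ (equivalently, $\ln h$ is a concave function of $\ln x$).
   Formalization: Part (e) is stated only for those x>0 with x+ν/2>0, since for −1/2<ν<0 and small x the base x+ν/2 is negative and its real power ν+1/2 is undefined (e.g. ν=−1/4, x=1/16); for ν≥0 this is all of (0,∞). *)

theory Defs
  imports "HOL-Analysis.Analysis"
begin

text \<open>Modified Bessel function of the first kind, via its power series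
  I_nu(x) = sum_m (x/2)^(2m+nu) / (m! Gamma(m+nu+1)), for x > 0.
  The reciprocal Gamma function rGamma is used so that the formula is the
  standard one for every real nu.\<close>
definition besselI :: "real \<Rightarrow> real \<Rightarrow> real" where
  "besselI nu x = (\<Sum>m. (x / 2) powr (2 * real m + nu) * rGamma (real m + nu + 1) / fact m)"

definition Phi :: "real \<Rightarrow> real \<Rightarrow> real" where
  "Phi nu x = exp (- x) * x powr (- nu) * (besselI nu x + besselI (nu + 1) x)"

definition completely_monotonic :: "(real \<Rightarrow> real) \<Rightarrow> bool" where
  "completely_monotonic f \<longleftrightarrow>
     (\<forall>m x. x > 0 \<longrightarrow> ((deriv ^^ m) f) differentiable (at x)) \<and>
     (\<forall>m x. x > 0 \<longrightarrow> (-1) ^ m * (deriv ^^ m) f x \<ge> 0)"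

definition log_convex_on :: "real set \<Rightarrow> (real \<Rightarrow> real) \<Rightarrow> bool" where
  "log_convex_on S g \<longleftrightarrow> (\<forall>x\<in>S. g x > 0) \<and> convex_on S (\<lambda>x. ln (g x))"

definition geom_concave_on :: "real set \<Rightarrow> (real \<Rightarrow> real) \<Rightarrow> bool" where
  "geom_concave_on S h \<longleftrightarrow> (\<forall>x\<in>S. h x > 0) \<and>
     (\<forall>x\<in>S. \<forall>y\<in>S. \<forall>l\<in>{0..1::real}.
        h (x powr l * y powr (1 - l)) \<ge> h x powr l * h y powr (1 - l))"

end

theory Submission
  imports Defs
begin

text \<open>With \<open>a = nu + 1/2\<close> and Kummer's series \<open>M p q\<close>, one has
  \<open>Phi nu x = C exp (- 2 x) M (a + 1) (2 a + 1) (2 x)\<close>, and differentiating \<open>exp (- y) M p q y\<close>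
  gives \<open>- (q - p) / q\<close> times the same function with \<open>q + 1\<close> for \<open>q\<close>. This yields complete
  monotonicity. The remaining properties in \<open>x\<close> are statements about the logarithmic derivative, a quotient
  of two power series whose coefficients have explicit ratios: \<open>a / (2 a + 1 + n)\<close> for \<open>- K' / K\<close>
  (decreasing, log-convexity) and \<open>a n / (a + n)\<close> for \<open>- y K' / K\<close> (increasing, geometric concavity),
  where \<open>K y = exp (- y) M (a + 1) (2 a + 1) y\<close>; their sum with weights \<open>a\<close> and \<open>1\<close> is less than \<open>a\<close>,
  so \<open>(y + a) powr a * K y\<close> increases, from its value at \<open>0\<close> to its limit at infinity.
  Monotonicity in \<open>nu\<close> holds term by term in the Bessel series because \<open>Digamma 1 > - ln 2\<close>.\<close>

section \<open>Kummer's series and its exponentially damped form\<close>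

definition kummer_coeff :: "real \<Rightarrow> real \<Rightarrow> nat \<Rightarrow> real" where
  "kummer_coeff p q n = pochhammer p n / (pochhammer q n * fact n)"

definition kummer :: "real \<Rightarrow> real \<Rightarrow> real \<Rightarrow> real" where
  "kummer p q y = (\<Sum>n. kummer_coeff p q n * y ^ n)"

lemma kummer_coeff_0 [simp]: "kummer_coeff p q 0 = 1"
  by (simp add: kummer_coeff_def)

lemma kummer_coeff_pos: "0 < p \<Longrightarrow> 0 < q \<Longrightarrow> 0 < kummer_coeff p q n"
  by (simp add: kummer_coeff_def pochhammer_pos)

lemma kummer_coeff_Suc:
  assumes "0 < q"
  shows "kummer_coeff p q (Suc n) = kummer_coeff p q n * (p + real n) / ((q + real n) * real (Suc n))"
  by (simp add: kummer_coeff_def pochhammer_Suc)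

text \<open>Splitting off the first or the last factor of \<open>pochhammer q (Suc n)\<close>
  compares the two denominators. Raising \<open>q\<close> thus acts as a multiplier on coefficients,
  the form needed for ratios of series.\<close>

lemma kummer_coeff_add1:
  assumes "0 < q"
  shows "kummer_coeff p (q + 1) n = kummer_coeff p q n * q / (q + real n)"
proof -
  have "q * pochhammer (q + 1) n = (q + real n) * pochhammer q n"
    using pochhammer_rec[of q n] pochhammer_rec'[of q n] by simp
  moreover have "pochhammer q n > 0" "pochhammer (q + 1) n > 0"
    using assms by (simp_all add: pochhammer_pos)
  moreover have "q + real n > 0" using assms by simp
  ultimately show ?thesis
    unfolding kummer_coeff_def by (simp add: divide_simps)
qed

lemma kummer_coeff_le:
  assumes "0 < p" "p \<le> q"
  shows "kummer_coeff p q n \<le> 1 / fact n"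
proof -
  have "pochhammer p n \<le> pochhammer q n"
  proof (induction n)
    case (Suc n)
    then show ?case using assms
      by (auto simp: pochhammer_Suc intro!: mult_mono pochhammer_nonneg)
  qed simp
  moreover have "pochhammer q n > 0" using assms by (simp add: pochhammer_pos)
  ultimately show ?thesis
    by (simp add: kummer_coeff_def field_simps)
qed

lemma summable_kummer:
  assumes "0 < p" "p \<le> q"
  shows "summable (\<lambda>n. kummer_coeff p q n * y ^ n)"
proof (rule summable_comparison_test')
  show "summable (\<lambda>n. \<bar>y\<bar> ^ n / fact n)"
    using summable_exp_generic[of "\<bar>y\<bar>"] by (simp add: scaleR_conv_of_real field_simps)
  show "norm (kummer_coeff p q n * y ^ n) \<le> \<bar>y\<bar> ^ n / fact n" for n
    using mult_right_mono[OF kummer_coeff_le[OF assms, of n], of "\<bar>y\<bar> ^ n"]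
      kummer_coeff_pos[of p q n] assms
    by (simp add: abs_mult power_abs)
qed

lemma kummer_pos:
  assumes "0 < p" "p \<le> q" "0 \<le> y"
  shows "0 < kummer p q y"
  unfolding kummer_def
proof (rule suminf_pos2[where i = 0])
  show "0 \<le> kummer_coeff p q n * y ^ n" for n
    using kummer_coeff_pos[of p q n] assms by simp
qed (use summable_kummer assms in auto)

lemma kummer_0 [simp]: "kummer p q 0 = 1"
  using powser_zero[of "kummer_coeff p q"] by (simp add: kummer_def)

definition kummer_exp :: "real \<Rightarrow> real \<Rightarrow> real \<Rightarrow> real" where
  "kummer_exp p q y = exp (- y) * kummer p q y"

lemma kummer_exp_pos: "0 < p \<Longrightarrow> p \<le> q \<Longrightarrow> 0 \<le> y \<Longrightarrow> 0 < kummer_exp p q y"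
  by (simp add: kummer_exp_def kummer_pos)

text \<open>Differentiating the series and subtracting the series multiplies coefficient
  \<open>n\<close> by \<open>(p + n) / (q + n) - 1 = - (q - p) / (q + n)\<close>; the factor
  \<open>1 / (q + n)\<close> is absorbed by raising \<open>q\<close>.\<close>

lemma DERIV_kummer_exp:
  assumes "0 < p" "p \<le> q"
  shows "(kummer_exp p q has_real_derivative - ((q - p) / q) * kummer_exp p (q + 1) y) (at y)"
proof -
  let ?c = "kummer_coeff p q"
  have d: "(kummer p q has_real_derivative (\<Sum>n. diffs ?c n * y ^ n)) (at y)"
    unfolding kummer_def [abs_def]
    using termdiffs_strong_converges_everywhere summable_kummer[OF assms] by blast
  have sd: "summable (\<lambda>n. diffs ?c n * y ^ n)"
    by (rule termdiff_converges_all[OF summable_kummer[OF assms]])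
  have "diffs ?c n - ?c n = - ((q - p) / q) * kummer_coeff p (q + 1) n" for n
  proof -
    have "q > 0" "q + real n > 0" using assms by auto
    then have "diffs ?c n = ?c n * (p + real n) / (q + real n)"
      by (simp add: diffs_def kummer_coeff_Suc del: of_nat_Suc)
    then show ?thesis
      using \<open>q > 0\<close> \<open>q + real n > 0\<close>
      by (simp add: kummer_coeff_add1 divide_simps) (simp add: algebra_simps)
  qed
  then have "diffs ?c n * y ^ n - ?c n * y ^ n
      = - ((q - p) / q) * (kummer_coeff p (q + 1) n * y ^ n)" for n
    by (metis left_diff_distrib mult.assoc)
  then have "(\<Sum>n. diffs ?c n * y ^ n) - kummer p q y = - ((q - p) / q) * kummer p (q + 1) y"
    unfolding kummer_def using suminf_diff[OF sd summable_kummer[OF assms, of y]]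
      suminf_mult[OF summable_kummer[of p "q + 1" y], of "- ((q - p) / q)"] assms
    by simp
  then have "exp (- y) * (\<Sum>n. diffs ?c n * y ^ n) - exp (- y) * kummer p q y
      = - ((q - p) / q) * kummer_exp p (q + 1) y"
    unfolding kummer_exp_def right_diff_distrib[symmetric] by (simp only: ac_simps)
  moreover have "(kummer_exp p q has_real_derivative
      exp (- y) * (\<Sum>n. diffs ?c n * y ^ n) - exp (- y) * kummer p q y) (at y)"
    unfolding kummer_exp_def [abs_def]
    by (rule derivative_eq_intros d refl)+ simp
  ultimately show ?thesis by simp
qed

section \<open>Monotonicity of ratios of power series\<close>

text \<open>For fixed \<open>x\<close> with \<open>r = A x / B x\<close>, the coefficients of \<open>A - r B\<close> change sign at most once,
  from negative to positive; passing from \<open>x\<close> to a larger \<open>y\<close> gives more weight to the positive ones.\<close>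

lemma power_series_ratio_mono:
  fixes b c :: "nat \<Rightarrow> real"
  assumes b: "\<And>n. 0 < b n" and c: "mono c"
    and sb: "\<And>z. summable (\<lambda>n. b n * z ^ n)"
    and sc: "\<And>z. summable (\<lambda>n. c n * b n * z ^ n)"
    and xy: "0 < x" "x \<le> y"
  shows "(\<Sum>n. c n * b n * x ^ n) / (\<Sum>n. b n * x ^ n)
       \<le> (\<Sum>n. c n * b n * y ^ n) / (\<Sum>n. b n * y ^ n)"
proof -
  define A where "A z = (\<Sum>n. c n * b n * z ^ n)" for z
  define B where "B z = (\<Sum>n. b n * z ^ n)" for z
  define r where "r = A x / B x"
  define e where "e n = (c n - r) * b n" for n
  have Bpos: "B z > 0" if "z > 0" for z
    unfolding B_def by (rule suminf_pos[OF sb]) (use b that in auto)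
  have e: "(\<lambda>n. e n * z ^ n) sums (A z - r * B z)" for z
    using sums_diff[OF summable_sums[OF sc[of z]] sums_mult[OF summable_sums[OF sb[of z]], of r]]
    by (simp add: A_def B_def e_def algebra_simps)
  have e0: "(\<lambda>n. e n * x ^ n) sums 0"
    using e[of x] Bpos[OF xy(1)] by (simp add: r_def)
  \<comment> \<open>Otherwise \<open>e0\<close> would be a series of negative terms with sum
    \<open>0\<close>.\<close>
  have "\<exists>n. r \<le> c n"
  proof (rule ccontr)
    assume "\<not> ?thesis"
    then have "0 < - e n * x ^ n" for n
      using b[of n] xy by (simp add: e_def not_le mult_neg_pos)
    moreover have "(\<lambda>n. - e n * x ^ n) sums 0"
      using sums_minus[OF e0] by simp
    ultimately show False
      using suminf_pos[of "\<lambda>n. - e n * x ^ n"] by (auto simp: sums_iff)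
  qed
  then obtain N where N: "r \<le> c N" and least: "\<And>n. n < N \<Longrightarrow> \<not> r \<le> c n"
    using LeastI_ex[of "\<lambda>n. r \<le> c n"] not_less_Least[of _ "\<lambda>n. r \<le> c n"] by metis
  have q: "y / x \<ge> 1" using xy by simp
  \<comment> \<open>The growth factor at the sign change \<open>N\<close> is a common yardstick: the
    nonpositive terms before \<open>N\<close> are scaled by at most this factor, the nonnegative
    ones from \<open>N\<close> on by at least it. The left sides sum to \<open>0\<close>.\<close>
  have le: "(y / x) ^ N * (e n * x ^ n) \<le> e n * y ^ n" for n
  proof -
    have y: "e n * y ^ n = (e n * x ^ n) * (y / x) ^ n"
      using xy by (simp add: power_divide)
    show ?thesis
    proof (cases "n < N")
      case True
      then have "e n * x ^ n \<le> 0"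
        using least[OF True] b[of n] xy by (simp add: e_def mult_nonpos_nonneg)
      moreover have "(y / x) ^ n \<le> (y / x) ^ N" using True q by (intro power_increasing) auto
      ultimately show ?thesis unfolding y by (metis mult.commute mult_left_mono_neg)
    next
      case False
      then have "r \<le> c n" using N monoD[OF c, of N n] by simp
      then have "e n * x ^ n \<ge> 0" using b[of n] xy by (simp add: e_def)
      moreover have "(y / x) ^ N \<le> (y / x) ^ n" using False q by (intro power_increasing) auto
      ultimately show ?thesis unfolding y by (metis mult.commute mult_left_mono)
    qed
  qed
  have "0 \<le> A y - r * B y"
    using sums_le[OF le sums_mult[OF e0] e[of y]] by simp
  then have "r \<le> A y / B y" using Bpos[of y] xy by (simp add: field_simps)
  then show ?thesis by (simp add: r_def A_def B_def)
qed

section \<open>The Bessel series and its transformation into Kummer's series\<close>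

text \<open>Coefficients of \<open>x powr (-nu) * (besselI nu x + besselI (nu + 1) x)\<close>: the even ones come from
  the first summand, the odd ones from the second.\<close>

definition bessel_coeff :: "real \<Rightarrow> nat \<Rightarrow> real" where
  "bessel_coeff nu n =
     2 powr (- nu) * rGamma (real (n - n div 2) + nu + 1) / (2 ^ n * fact (n div 2))"

text \<open>The Gamma argument contains \<open>n / 2\<close> rounded up, the factorial
  \<open>n / 2\<close> rounded down. Apart from the power of 2, a step from an even index changes
  only the former, a step from an odd index only the latter.\<close>

lemma bessel_coeff_Suc_even:
  assumes "even n"
  shows "(real n + 2 * nu + 2) * bessel_coeff nu (Suc n) = bessel_coeff nu n"
proof -
  obtain m where n: "n = 2 * m" using assms by blast
  have m: "Suc (2 * m) - m = Suc m" "2 * m - m = m" by simp_all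
  have "rGamma (real m + nu + 1) = (real m + nu + 1) * rGamma (real (Suc m) + nu + 1)"
    using rGamma_plus1[of "real m + nu + 1"] by (simp add: add_ac)
  then show ?thesis
    unfolding bessel_coeff_def n by (simp add: m field_simps del: of_nat_Suc)
qed

lemma bessel_coeff_Suc_odd:
  assumes "odd n"
  shows "real (Suc n) * bessel_coeff nu (Suc n) = bessel_coeff nu n"
proof -
  obtain m where n: "n = Suc (2 * m)" using assms by (metis oddE Suc_eq_plus1)
  have "Suc (Suc (2 * m)) - Suc m = Suc m" "Suc (2 * m) - m = Suc m" by simp_all
  then show ?thesis
    by (simp add: n bessel_coeff_def divide_simps)
qed

lemma bessel_coeff_nonneg: "-1 < nu \<Longrightarrow> 0 \<le> bessel_coeff nu n"
  by (auto simp: bessel_coeff_def rGamma_inverse_Gamma intro!: divide_nonneg_nonneg mult_nonneg_nonneg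
        less_imp_le[OF Gamma_real_pos])

text \<open>In either parity a coefficient is at most \<open>1 / n\<close> times its predecessor, so
  once \<open>n\<close> reaches \<open>2 * \<bar>x\<bar>\<close> each term is at most half the
  preceding one.\<close>

lemma summable_bessel_coeff:
  assumes "-1 < nu"
  shows "summable (\<lambda>n. bessel_coeff nu n * x ^ n)"
proof (rule summable_ratio_test)
  fix n assume n: "max 1 (nat \<lceil>2 * \<bar>x\<bar>\<rceil>) \<le> n"
  have nx: "2 * \<bar>x\<bar> \<le> real n" using n by linarith
  have b0: "0 \<le> bessel_coeff nu k" for k using bessel_coeff_nonneg[OF assms] .
  have "real n * bessel_coeff nu (Suc n) \<le> bessel_coeff nu n"
  proof (cases "even n")
    case True
    have "real n * bessel_coeff nu (Suc n) \<le> (real n + 2 * nu + 2) * bessel_coeff nu (Suc n)"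
      using assms b0 by (intro mult_right_mono) auto
    then show ?thesis using bessel_coeff_Suc_even[OF True] by simp
  next
    case False
    have "real n * bessel_coeff nu (Suc n) \<le> real (Suc n) * bessel_coeff nu (Suc n)"
      using b0 by (intro mult_right_mono) auto
    then show ?thesis using bessel_coeff_Suc_odd[OF False] by simp
  qed
  moreover have "2 * \<bar>x\<bar> * bessel_coeff nu (Suc n) \<le> real n * bessel_coeff nu (Suc n)"
    using nx b0 by (rule mult_right_mono)
  ultimately have "2 * \<bar>x\<bar> * bessel_coeff nu (Suc n) \<le> bessel_coeff nu n" by simp
  then have "2 * \<bar>x\<bar> * bessel_coeff nu (Suc n) * \<bar>x\<bar> ^ n \<le> bessel_coeff nu n * \<bar>x\<bar> ^ n"
    by (rule mult_right_mono) simp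
  then show "norm (bessel_coeff nu (Suc n) * x ^ Suc n) \<le> 1 / 2 * norm (bessel_coeff nu n * x ^ n)"
    using b0 by (simp add: abs_mult power_abs algebra_simps)
qed simp

text \<open>Inserting one parity rule into the other removes the distinction of parities, at the
  price of order two. This is the coefficient form of a linear differential equation.\<close>

lemma bessel_coeff_recurrence:
  "real (Suc n) * (real n + 2 * nu + 2) * bessel_coeff nu (Suc n)
     = bessel_coeff nu n + (if n = 0 then 0 else bessel_coeff nu (n - 1))"
proof (cases n)
  case 0
  then show ?thesis using bessel_coeff_Suc_even[of 0 nu] by simp
next
  case (Suc m)
  show ?thesis
  proof (cases "even n")
    case True
    then have "real n * bessel_coeff nu n = bessel_coeff nu m"
      using bessel_coeff_Suc_odd[of m nu] Suc by simp
    moreover have "real (Suc n) * (real n + 2 * nu + 2) * bessel_coeff nu (Suc n)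
      = bessel_coeff nu n + real n * bessel_coeff nu n"
      unfolding bessel_coeff_Suc_even[OF True, of nu, symmetric] by (simp add: algebra_simps)
    ultimately show ?thesis using Suc by simp
  next
    case False
    then have "(real m + 2 * nu + 2) * bessel_coeff nu n = bessel_coeff nu m"
      using bessel_coeff_Suc_even[of m nu] Suc by simp
    moreover have "real (Suc n) * (real n + 2 * nu + 2) * bessel_coeff nu (Suc n)
      = (real m + 2 * nu + 2) * bessel_coeff nu n + bessel_coeff nu n"
      unfolding bessel_coeff_Suc_odd[OF False, of nu, symmetric] by (simp add: Suc algebra_simps)
    ultimately show ?thesis using Suc by simp
  qed
qed

text \<open>Multiplying \<open>\<Sum>n. bessel_coeff nu n * x ^ n\<close> by \<open>exp x\<close> turns its differential equation
  into Kummer's.\<close>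

lemma exp_times_bessel_coeff:
  assumes "-1 < nu"
  shows "(\<Sum>i\<le>n. inverse (fact i) * bessel_coeff nu (n - i))
       = bessel_coeff nu 0 * 2 ^ n * kummer_coeff (nu + 3/2) (2 * nu + 2) n"
proof -
  define q where "q = 2 * nu + 2"
  define B where "B = Abs_fps (bessel_coeff nu)"
  define G where "G = fps_exp 1 * B"
  have q: "q > 0" using assms by (simp add: q_def)
  have "fps_X * fps_deriv (fps_deriv B) + fps_const q * fps_deriv B = (fps_X + 1) * B"
    (is "?l = ?r")
  proof (rule fps_ext)
    fix n
    show "fps_nth ?l n = fps_nth ?r n"
      using bessel_coeff_recurrence[of n nu]
      by (cases n) (simp_all add: B_def q_def algebra_simps)
  qed
  moreover have "fps_deriv G = fps_exp 1 * (B + fps_deriv B)"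
    and "fps_deriv (fps_deriv G) = fps_exp 1 * (B + 2 * fps_deriv B + fps_deriv (fps_deriv B))"
    by (simp_all add: G_def algebra_simps)
  then have "fps_X * fps_deriv (fps_deriv G) + fps_const q * fps_deriv G
        - (2 * fps_X * fps_deriv G + (fps_const q + 1) * G)
      = fps_exp 1 * (fps_X * fps_deriv (fps_deriv B) + fps_const q * fps_deriv B - (fps_X + 1) * B)"
    by (simp add: G_def algebra_simps)
  \<comment> \<open>Kummer's equation in the variable \<open>2 * x\<close>, with parameters
    \<open>(q + 1) / 2 = nu + 3/2\<close> and \<open>q\<close>.\<close>
  ultimately have ode: "fps_X * fps_deriv (fps_deriv G) + fps_const q * fps_deriv G
      = 2 * fps_X * fps_deriv G + (fps_const q + 1) * G"
    by simp
  have rec: "real (Suc n) * (real n + q) * fps_nth G (Suc n) = 2 * (real n + nu + 3/2) * fps_nth G n" for n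
  proof -
    have "fps_nth (fps_X * fps_deriv (fps_deriv G) + fps_const q * fps_deriv G) n
      = fps_nth (2 * fps_X * fps_deriv G + (fps_const q + 1) * G) n"
      using ode by simp
    then show ?thesis
      by (cases n) (simp_all add: q_def numeral_fps_const mult.assoc algebra_simps)
  qed
  have "fps_nth G n = bessel_coeff nu 0 * 2 ^ n * kummer_coeff (nu + 3/2) q n"
  proof (induction n)
    case 0
    then show ?case by (simp add: G_def B_def)
  next
    case (Suc n)
    have "real (Suc n) * (real n + q) > 0" using q by simp
    moreover have "real (Suc n) * (real n + q) * fps_nth G (Suc n)
      = real (Suc n) * (real n + q) * (bessel_coeff nu 0 * 2 ^ Suc n * kummer_coeff (nu + 3/2) q (Suc n))"
      unfolding rec Suc kummer_coeff_Suc[OF q] using calculation q by (simp add: field_simps del: of_nat_Suc)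
    ultimately show ?case by (metis mult_left_cancel less_irrefl)
  qed
  moreover have "fps_nth G n = (\<Sum>i\<le>n. inverse (fact i) * bessel_coeff nu (n - i))"
    by (simp add: G_def B_def fps_mult_nth inverse_eq_divide atLeast0AtMost)
  ultimately show ?thesis by (simp add: q_def)
qed

text \<open>Once \<open>x powr nu\<close> is removed, order \<open>nu\<close> supplies the even
  powers and order \<open>nu + 1\<close> the odd ones. Nonnegative terms allow passing to these
  subseries.\<close>

lemma besselI_add_besselI:
  assumes "-1 < nu" "0 < x"
  shows "x powr (- nu) * (besselI nu x + besselI (nu + 1) x) = (\<Sum>n. bessel_coeff nu n * x ^ n)"
proof -
  let ?b = "\<lambda>n. bessel_coeff nu n * x ^ n"
  have sb: "summable ?b" by (rule summable_bessel_coeff[OF assms(1)])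
  have nb: "0 \<le> ?b n" for n using bessel_coeff_nonneg[OF assms(1)] assms by simp
  have sub: "summable (\<lambda>m. ?b (f m))" if "strict_mono f" for f :: "nat \<Rightarrow> nat"
    using summable_reindex[OF sb _ nb] strict_mono_imp_inj_on[OF that] by (simp add: o_def)
  have even: "x powr nu * ?b (2 * m) = (x / 2) powr (2 * real m + nu) * rGamma (real m + nu + 1) / fact m" for m
  proof -
    have "(x / 2) powr (2 * real m + nu) = x powr nu * 2 powr (- nu) * x ^ (2 * m) / 2 ^ (2 * m)"
      using assms powr_realpow[of "x / 2" "2 * m"]
      by (simp add: powr_add powr_divide powr_minus field_simps)
    then show ?thesis by (simp add: bessel_coeff_def)
  qed
  have odd: "x powr nu * ?b (Suc (2 * m))
     = (x / 2) powr (2 * real m + (nu + 1)) * rGamma (real m + (nu + 1) + 1) / fact m" for m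
  proof -
    have "(x / 2) powr (2 * real m + (nu + 1)) = x powr nu * 2 powr (- nu) * x ^ Suc (2 * m) / 2 ^ Suc (2 * m)"
      using assms powr_realpow[of "x / 2" "2 * m"]
      by (simp add: powr_add powr_divide powr_minus field_simps)
    moreover have "real (Suc (2 * m) - m) + nu + 1 = real m + (nu + 1) + 1"
      by (simp add: Suc_diff_le)
    ultimately show ?thesis by (simp add: bessel_coeff_def Suc_diff_le algebra_simps)
  qed
  have s1: "(\<lambda>m. ?b (2 * m)) sums (x powr (- nu) * besselI nu x)"
    and s2: "(\<lambda>m. ?b (Suc (2 * m))) sums (x powr (- nu) * besselI (nu + 1) x)"
  proof -
    have c: "x powr (- nu) * (x powr nu * z) = z" for z
      using assms by (simp add: powr_minus)
    have "summable (\<lambda>m. ?b (2 * m))" "summable (\<lambda>m. ?b (Suc (2 * m)))"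
      by (rule sub; simp add: strict_mono_def)+
    note this[THEN summable_sums, THEN sums_mult, of "x powr nu"]
    then have "besselI nu x = x powr nu * (\<Sum>m. ?b (2 * m))"
      "besselI (nu + 1) x = x powr nu * (\<Sum>m. ?b (Suc (2 * m)))"
      unfolding even odd besselI_def by (simp_all only: sums_iff)
    then show "(\<lambda>m. ?b (2 * m)) sums (x powr (- nu) * besselI nu x)"
      "(\<lambda>m. ?b (Suc (2 * m))) sums (x powr (- nu) * besselI (nu + 1) x)"
      using \<open>summable (\<lambda>m. ?b (2 * m))\<close> \<open>summable (\<lambda>m. ?b (Suc (2 * m)))\<close>
      by (simp_all only: c summable_sums)
  qed
  \<comment> \<open>The shape in which \<open>sums_if\<close> delivers the interleaved
    series.\<close>
  have "(\<lambda>n. if even n then ?b (2 * (n div 2)) else ?b (Suc (2 * ((n - 1) div 2)))) = ?b"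
    by (auto simp: fun_eq_iff elim!: oddE)
  then show ?thesis
    using sums_if[OF s2 s1] by (simp add: sums_iff algebra_simps)
qed

text \<open>The Cauchy product of \<open>exp x\<close> with the Bessel series is Kummer's series in
  \<open>2 * x\<close>, so \<open>exp (- x)\<close> is split as
  \<open>exp (- 2 * x) * exp x\<close>. For these parameters \<open>p \<le> q\<close> means exactly
  \<open>-1/2 \<le> nu\<close>.\<close>

lemma Phi_eq_kummer_exp:
  assumes "-1/2 \<le> nu" "0 < x"
  shows "Phi nu x = 2 powr (- nu) / Gamma (nu + 1) * kummer_exp (nu + 3/2) (2 * nu + 2) (2 * x)"
proof -
  have nu: "-1 < nu" using assms by simp
  let ?b = "\<lambda>n. bessel_coeff nu n * x ^ n"
  let ?e = "\<lambda>n. inverse (fact n) * x ^ n"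
  have nb: "norm (?b n) = ?b n" for n using bessel_coeff_nonneg[OF nu] assms by simp
  have "(\<lambda>n. \<Sum>i\<le>n. ?e i * ?b (n - i)) sums ((\<Sum>n. ?e n) * (\<Sum>n. ?b n))"
  proof (rule Cauchy_product_sums)
    show "summable (\<lambda>n. norm (?e n))" using assms summable_exp[of x] by simp
    show "summable (\<lambda>n. norm (?b n))" unfolding nb by (rule summable_bessel_coeff[OF nu])
  qed
  moreover have "(\<Sum>n. ?e n) = exp x"
    using exp_converges[of x] by (simp add: sums_iff scaleR_conv_of_real)
  moreover have "(\<Sum>i\<le>n. ?e i * ?b (n - i))
      = bessel_coeff nu 0 * (kummer_coeff (nu + 3/2) (2 * nu + 2) n * (2 * x) ^ n)" for n
  proof -
    have "(\<Sum>i\<le>n. ?e i * ?b (n - i)) = (\<Sum>i\<le>n. inverse (fact i) * bessel_coeff nu (n - i)) * x ^ n"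
      unfolding sum_distrib_right
      by (rule sum.cong) (auto simp: power_add[symmetric] algebra_simps)
    then show ?thesis
      unfolding exp_times_bessel_coeff[OF nu] by (simp add: power_mult_distrib)
  qed
  moreover have "(\<lambda>n. bessel_coeff nu 0 * (kummer_coeff (nu + 3/2) (2 * nu + 2) n * (2 * x) ^ n))
      sums (bessel_coeff nu 0 * kummer (nu + 3/2) (2 * nu + 2) (2 * x))"
    unfolding kummer_def
    by (intro sums_mult summable_sums summable_kummer) (use assms in auto)
  ultimately have "exp x * (\<Sum>n. ?b n) = bessel_coeff nu 0 * kummer (nu + 3/2) (2 * nu + 2) (2 * x)"
    by (simp add: sums_iff)
  moreover have "Phi nu x = exp (- 2 * x) * (exp x * (\<Sum>n. ?b n))"
    using besselI_add_besselI[OF nu assms(2)] unfolding Phi_def mult.assoc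
    by (simp add: mult.assoc[symmetric] exp_add[symmetric])
  ultimately show ?thesis
    by (simp add: kummer_exp_def bessel_coeff_def rGamma_inverse_Gamma field_simps)
qed

section \<open>Complete monotonicity\<close>

text \<open>Each differentiation raises \<open>q\<close> by one and brings out the nonpositive
  factor \<open>- 2 * (q - p) / q\<close>, so only a sign and a nonnegative constant
  accumulate.\<close>

lemma higher_deriv_kummer_exp:
  assumes pq: "0 < p" "p \<le> q"
    and f: "\<And>x. 0 < x \<Longrightarrow> f x = C * kummer_exp p q (2 * x)"
    and "0 \<le> C"
  shows "\<exists>c\<ge>0. \<forall>x>0. (deriv ^^ m) f x = (-1) ^ m * c * kummer_exp p (q + real m) (2 * x)"
proof (induction m)
  case 0
  then show ?case using f \<open>0 \<le> C\<close> by auto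
next
  case (Suc m)
  then obtain c where c: "0 \<le> c"
    and eq: "\<And>x. 0 < x \<Longrightarrow> (deriv ^^ m) f x = (-1) ^ m * c * kummer_exp p (q + real m) (2 * x)"
    by blast
  let ?q = "q + real m"
  define c' where "c' = 2 * c * ((?q - p) / ?q)"
  have "(deriv ^^ Suc m) f x = (-1) ^ Suc m * c' * kummer_exp p (q + real (Suc m)) (2 * x)" if "0 < x" for x
  proof -
    have "((\<lambda>x. (-1) ^ m * c * kummer_exp p ?q (2 * x)) has_real_derivative
        (-1) ^ m * c * (- ((?q - p) / ?q) * kummer_exp p (?q + 1) (2 * x) * 2)) (at x)"
      using pq by (intro DERIV_cmult DERIV_chain2[OF DERIV_kummer_exp]) (auto intro!: derivative_eq_intros)
    \<comment> \<open>The formula for the derivative of order \<open>m\<close> is known only on the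
      open half-line, which is enough to transfer its derivative.\<close>
    then have "((deriv ^^ m) f has_real_derivative
        (-1) ^ m * c * (- ((?q - p) / ?q) * kummer_exp p (?q + 1) (2 * x) * 2)) (at x)"
      by (rule has_field_derivative_transform_within_open[of _ _ _ "{0<..}"]) (use that eq in auto)
    from DERIV_imp_deriv[OF this] show ?thesis
      by (simp add: c'_def add_ac)
  qed
  moreover have "0 \<le> c'" using c pq by (simp add: c'_def)
  ultimately show ?case by blast
qed

lemma completely_monotonic_kummer_exp:
  assumes pq: "0 < p" "p \<le> q"
    and f: "\<And>x. 0 < x \<Longrightarrow> f x = C * kummer_exp p q (2 * x)"
    and "0 \<le> C"
  shows "completely_monotonic f"
  unfolding completely_monotonic_def
proof (intro conjI allI impI)
  fix m and x :: real assume x: "0 < x"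
  obtain c where c: "0 \<le> c"
    and eq: "\<And>x. 0 < x \<Longrightarrow> (deriv ^^ m) f x = (-1) ^ m * c * kummer_exp p (q + real m) (2 * x)"
    using higher_deriv_kummer_exp[OF assms, of m] by blast
  let ?q = "q + real m"
  have "((\<lambda>x. (-1) ^ m * c * kummer_exp p ?q (2 * x)) has_real_derivative
      (-1) ^ m * c * (- ((?q - p) / ?q) * kummer_exp p (?q + 1) (2 * x) * 2)) (at x)"
    using pq by (intro DERIV_cmult DERIV_chain2[OF DERIV_kummer_exp]) (auto intro!: derivative_eq_intros)
  then have "((deriv ^^ m) f has_real_derivative
      (-1) ^ m * c * (- ((?q - p) / ?q) * kummer_exp p (?q + 1) (2 * x) * 2)) (at x)"
    by (rule has_field_derivative_transform_within_open[of _ _ _ "{0<..}"]) (use x eq in auto)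
  then show "(deriv ^^ m) f differentiable at x"
    unfolding real_differentiable_def by blast
  have "0 \<le> c * kummer_exp p ?q (2 * x)"
    using c x pq kummer_exp_pos[of p ?q "2 * x"] by simp
  then show "0 \<le> (-1) ^ m * (deriv ^^ m) f x"
    by (simp add: eq[OF x] mult.assoc[symmetric] power_mult_distrib[symmetric])
qed

section \<open>The logarithmic derivative as a ratio of power series\<close>

text \<open>Minus the logarithmic derivative of \<open>kummer_exp (a + 1) (2 * a + 1)\<close>; the
  leading factor is \<open>(q - p) / q\<close> at these parameters.\<close>

definition kummer_ratio :: "real \<Rightarrow> real \<Rightarrow> real" where
  "kummer_ratio a y = a / (2 * a + 1) * kummer_exp (a + 1) (2 * a + 2) y / kummer_exp (a + 1) (2 * a + 1) y"

lemma DERIV_ln_kummer_exp: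
  assumes "0 \<le> a" "0 \<le> y"
  shows "((\<lambda>y. ln (kummer_exp (a + 1) (2 * a + 1) y)) has_real_derivative - kummer_ratio a y) (at y)"
  using DERIV_kummer_exp[of "a + 1" "2 * a + 1" y] kummer_exp_pos[of "a + 1" "2 * a + 1" y] assms
  by (auto intro!: derivative_eq_intros simp: kummer_ratio_def algebra_simps)

lemma kummer_ratio_altdef:
  "kummer_ratio a y = a / (2 * a + 1) * kummer (a + 1) (2 * a + 2) y / kummer (a + 1) (2 * a + 1) y"
  by (simp add: kummer_ratio_def kummer_exp_def)

lemma kummer_contiguous_sums:
  assumes "0 \<le> a"
  shows "(\<lambda>n. a / (2 * a + 1 + real n) * kummer_coeff (a + 1) (2 * a + 1) n * y ^ n)
      sums (a / (2 * a + 1) * kummer (a + 1) (2 * a + 2) y)"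
proof -
  have "(\<lambda>n. a / (2 * a + 1) * (kummer_coeff (a + 1) (2 * a + 2) n * y ^ n))
      sums (a / (2 * a + 1) * kummer (a + 1) (2 * a + 2) y)"
    unfolding kummer_def
    by (intro sums_mult summable_sums summable_kummer) (use assms in auto)
  moreover have "a / (2 * a + 1) * (kummer_coeff (a + 1) (2 * a + 2) n * y ^ n)
      = a / (2 * a + 1 + real n) * kummer_coeff (a + 1) (2 * a + 1) n * y ^ n" for n
    using kummer_coeff_add1[of "2 * a + 1" "a + 1" n] assms by (simp add: add_ac)
  ultimately show ?thesis by simp
qed

text \<open>The factor \<open>y\<close> shifts the index by one, and \<open>kummer_coeff_Suc\<close>
  rewrites the shifted coefficient as a multiple of the one at the new index. The term at index
  \<open>0\<close> vanishes.\<close>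

lemma kummer_contiguous_sums':
  assumes "0 \<le> a"
  shows "(\<lambda>n. a * real n / (a + real n) * kummer_coeff (a + 1) (2 * a + 1) n * y ^ n)
      sums (y * (a / (2 * a + 1) * kummer (a + 1) (2 * a + 2) y))"
proof -
  let ?m = "kummer_coeff (a + 1) (2 * a + 1)"
  have "a * real (Suc n) / (a + real (Suc n)) * ?m (Suc n) * y ^ Suc n
      = y * (a / (2 * a + 1 + real n) * ?m n * y ^ n)" for n
  proof -
    have "a + 1 + real n > 0" "2 * a + 1 + real n > 0" using assms by simp_all
    then have "a * S / (a + 1 + real n) * (?m n * (a + 1 + real n) / ((2 * a + 1 + real n) * S))
        = a / (2 * a + 1 + real n) * ?m n" if "S > 0" for S
      using that by simp
    from this[of "real (Suc n)"] show ?thesis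
      using kummer_coeff_Suc[of "2 * a + 1" "a + 1" n] assms by (simp add: add_ac)
  qed
  then have "(\<lambda>n. a * real (Suc n) / (a + real (Suc n)) * ?m (Suc n) * y ^ Suc n)
      sums (y * (a / (2 * a + 1) * kummer (a + 1) (2 * a + 2) y))"
    using sums_mult[OF kummer_contiguous_sums[OF assms, of y], of y] by simp
  then show ?thesis
    using sums_Suc_iff[of "\<lambda>n. a * real n / (a + real n) * ?m n * y ^ n"] by simp
qed

lemma kummer_ratio_antimono:
  assumes "0 \<le> a" "0 < x" "x \<le> y"
  shows "kummer_ratio a y \<le> kummer_ratio a x"
proof -
  define m where "m = kummer_coeff (a + 1) (2 * a + 1)"
  \<comment> \<open>Negated, because \<open>power_series_ratio_mono\<close> asks for increasing
    multipliers.\<close>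
  define c where "c n = - (a / (2 * a + 1 + real n))" for n
  have s: "(\<lambda>n. c n * m n * z ^ n) sums - (a / (2 * a + 1) * kummer (a + 1) (2 * a + 2) z)" for z
    using sums_minus[OF kummer_contiguous_sums[OF assms(1), of z]] by (simp add: c_def m_def)
  have "(\<Sum>n. c n * m n * x ^ n) / (\<Sum>n. m n * x ^ n) \<le> (\<Sum>n. c n * m n * y ^ n) / (\<Sum>n. m n * y ^ n)"
  proof (rule power_series_ratio_mono)
    show "mono c"
      unfolding c_def using assms by (intro monoI) (simp add: frac_le)
    show "0 < m n" for n unfolding m_def by (rule kummer_coeff_pos) (use assms in auto)
    show "summable (\<lambda>n. m n * z ^ n)" for z
      unfolding m_def by (rule summable_kummer) (use assms in auto)
    show "summable (\<lambda>n. c n * m n * z ^ n)" for z using s by (rule sums_summable)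
  qed (use assms in auto)
  then show ?thesis
    unfolding s[THEN sums_unique, symmetric] kummer_ratio_altdef
    by (simp add: m_def kummer_def)
qed

lemma mult_kummer_ratio_mono:
  assumes "0 \<le> a" "0 < x" "x \<le> y"
  shows "x * kummer_ratio a x \<le> y * kummer_ratio a y"
proof -
  define m where "m = kummer_coeff (a + 1) (2 * a + 1)"
  define c where "c n = a * real n / (a + real n)" for n
  have s: "(\<lambda>n. c n * m n * z ^ n) sums (z * (a / (2 * a + 1) * kummer (a + 1) (2 * a + 2) z))" for z
    using kummer_contiguous_sums'[OF assms(1), of z] by (simp add: c_def m_def)
  have "(\<Sum>n. c n * m n * x ^ n) / (\<Sum>n. m n * x ^ n) \<le> (\<Sum>n. c n * m n * y ^ n) / (\<Sum>n. m n * y ^ n)"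
  proof (rule power_series_ratio_mono)
    show "mono c"
    \<comment> \<open>For \<open>a = 0\<close> all multipliers vanish, at \<open>n = 0\<close> by
      the convention \<open>0 / 0 = 0\<close>; otherwise every denominator is positive.\<close>
    proof (cases "a = 0")
      case True
      then show ?thesis by (simp add: c_def mono_def)
    next
      case False
      then have a: "0 < a + real n" for n using assms(1) by simp
      \<comment> \<open>Cross-multiplied, this is \<open>a * a * i \<le> a * a * j\<close>.\<close>
      have "c i \<le> c j" if "i \<le> j" for i j
        using mult_left_mono[of "real i" "real j" "a * a"] that assms
        unfolding c_def frac_le_eq divide_le_eq pos_divide_le_eq[OF a] pos_le_divide_eq[OF a]
        by (simp add: a pos_divide_le_eq pos_le_divide_eq algebra_simps)
      then show ?thesis by (rule monoI)
    qed
    show "0 < m n" for n unfolding m_def by (rule kummer_coeff_pos) (use assms in auto)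
    show "summable (\<lambda>n. m n * z ^ n)" for z
      unfolding m_def by (rule summable_kummer) (use assms in auto)
    show "summable (\<lambda>n. c n * m n * z ^ n)" for z using s by (rule sums_summable)
  qed (use assms in auto)
  then show ?thesis
    unfolding s[THEN sums_unique, symmetric] kummer_ratio_altdef
    by (simp add: m_def kummer_def)
qed

text \<open>All coefficients of \<open>M - (y + a) / (2 a + 1) M'\<close> are positive, where
  \<open>M = kummer (a + 1) (2 a + 1)\<close> and \<open>M' = kummer (a + 1) (2 a + 2)\<close>.\<close>

lemma kummer_ratio_less:
  assumes "0 < a" "0 \<le> y"
  shows "kummer_ratio a y < a / (y + a)"
proof -
  let ?m = "kummer_coeff (a + 1) (2 * a + 1)"
  let ?M = "kummer (a + 1) (2 * a + 1) y"
  let ?M' = "kummer (a + 1) (2 * a + 2) y"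
  have M: "?M > 0" using assms by (intro kummer_pos) auto
  define d where "d n = a * (1 - real n / (a + real n) - a / (2 * a + 1 + real n)) * ?m n * y ^ n" for n
  have m: "(\<lambda>n. ?m n * y ^ n) sums ?M"
    unfolding kummer_def by (intro summable_sums summable_kummer) (use assms in auto)
  have "d sums (a * ?M - y * (a / (2 * a + 1) * ?M') - a * (a / (2 * a + 1) * ?M'))"
  proof -
    have "(\<lambda>n. a * (?m n * y ^ n) - a * real n / (a + real n) * ?m n * y ^ n
        - a * (a / (2 * a + 1 + real n) * ?m n * y ^ n))
      sums (a * ?M - y * (a / (2 * a + 1) * ?M') - a * (a / (2 * a + 1) * ?M'))"
      using assms by (intro sums_diff sums_mult m kummer_contiguous_sums kummer_contiguous_sums') auto
    then show ?thesis by (simp add: d_def [abs_def] algebra_simps)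
  qed
  moreover have pos: "0 < a * (1 - real n / (a + real n) - a / (2 * a + 1 + real n)) * ?m n" for n
  proof -
    have "1 - real n / (a + real n) = a / (a + real n)" using assms by (simp add: field_simps)
    moreover have "a / (2 * a + 1 + real n) < a / (a + real n)"
      using assms by (intro divide_strict_left_mono) auto
    ultimately show ?thesis using assms kummer_coeff_pos[of "a + 1" "2 * a + 1" n] by simp
  qed
  have "0 < suminf d"
  \<comment> \<open>At \<open>y = 0\<close> only the constant term survives, so strictness is drawn
    from index \<open>0\<close>.\<close>
  proof (rule suminf_pos2[where i = 0])
    show "0 \<le> d n" for n unfolding d_def using pos[of n] assms by simp
    show "0 < d 0" unfolding d_def using pos[of 0] by simp
  qed (use calculation sums_summable in blast)
  ultimately have "(y + a) * (a / (2 * a + 1) * ?M') < a * ?M"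
    by (simp only: sums_iff distrib_right)
  moreover have "N / ?M < a / (y + a)" if "(y + a) * N < a * ?M" for N
    using that assms M by (simp add: field_simps)
  ultimately show ?thesis unfolding kummer_ratio_altdef by blast
qed

section \<open>The weighted function\<close>

text \<open>At \<open>y = 2 * x\<close> and \<open>a = nu + 1/2\<close> this is, up to a positive
  constant, the function of claim (f).\<close>

definition weighted_kummer_exp :: "real \<Rightarrow> real \<Rightarrow> real" where
  "weighted_kummer_exp a y = (y + a) powr a * kummer_exp (a + 1) (2 * a + 1) y"

text \<open>Its logarithm has derivative \<open>a / (y + a) - kummer_ratio a y\<close>, positive by
  \<open>kummer_ratio_less\<close>. The endpoint \<open>0\<close> is included for the lower bound on
  \<open>Phi\<close>.\<close>

lemma weighted_kummer_exp_strict_mono: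
  assumes "0 < a" "0 \<le> x" "x < y"
  shows "weighted_kummer_exp a x < weighted_kummer_exp a y"
proof -
  let ?k = "kummer_exp (a + 1) (2 * a + 1)"
  have "\<exists>D. ((\<lambda>y. a * ln (y + a) + ln (?k y)) has_real_derivative D) (at z) \<and> 0 < D" if "x \<le> z" for z
  proof (intro exI conjI)
    show "((\<lambda>y. a * ln (y + a) + ln (?k y)) has_real_derivative a / (z + a) - kummer_ratio a z) (at z)"
      unfolding diff_conv_add_uminus
      by (rule DERIV_add[OF _ DERIV_ln_kummer_exp])
         (use assms that in \<open>auto intro!: derivative_eq_intros\<close>)
    show "0 < a / (z + a) - kummer_ratio a z" using kummer_ratio_less[of a z] assms that by simp
  qed
  then have less: "a * ln (x + a) + ln (?k x) < a * ln (y + a) + ln (?k y)"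
    using DERIV_pos_imp_increasing[OF assms(3)] by blast
  have "weighted_kummer_exp a z = exp (a * ln (z + a) + ln (?k z))" if "0 \<le> z" for z
    using assms that kummer_exp_pos[of "a + 1" "2 * a + 1" z]
    by (simp add: weighted_kummer_exp_def exp_add powr_def)
  then show ?thesis using less assms by simp
qed

lemma weighted_kummer_exp_mono:
  assumes "0 \<le> a" "0 < x" "x \<le> y"
  shows "weighted_kummer_exp a x \<le> weighted_kummer_exp a y"
proof (cases "a = 0 \<or> x = y")
  case True
  \<comment> \<open>For \<open>a = 0\<close> the weighted function is constantly \<open>1\<close> on
    positive arguments; at \<open>0\<close> it would be \<open>0\<close>, since
    \<open>0 powr 0 = 0\<close>.\<close>
  have "kummer 1 1 z = exp z" for z
    by (simp add: kummer_def kummer_coeff_def exp_def pochhammer_fact[symmetric] scaleR_conv_of_real)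
       (simp add: divide_inverse mult.commute)
  then have "kummer_exp 1 1 z = 1" for z
    by (simp add: kummer_exp_def exp_add[symmetric])
  then show ?thesis using True assms by (auto simp: weighted_kummer_exp_def)
next
  case False
  then show ?thesis using weighted_kummer_exp_strict_mono[of a x y] assms by simp
qed

section \<open>Decay of the damped Kummer function via Beta and Gamma integrals\<close>

text \<open>Euler's Beta integral, with Pochhammer symbols written as Gamma quotients. The power of
  \<open>1 - v\<close> carries \<open>n\<close>, so that \<open>v powr (q - p - 1)\<close> matches
  the Gamma integrand.\<close>

lemma kummer_coeff_beta:
  assumes "0 < p" "p < q"
  shows "((\<lambda>v. v powr (q - p - 1) * (1 - v) powr (real n + p - 1)) has_integral
           Gamma p * Gamma (q - p) / Gamma q * (fact n * kummer_coeff p q n)) {0..1}"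
proof -
  have "((\<lambda>v. v powr (q - p - 1) * (1 - v) powr (real n + p - 1)) has_integral Beta (q - p) (real n + p)) {0..1}"
    by (rule has_integral_Beta_real) (use assms in auto)
  moreover have "p \<notin> \<int>\<^sub>\<le>\<^sub>0" "q \<notin> \<int>\<^sub>\<le>\<^sub>0" using assms by (auto dest: nonpos_Ints_nonpos)
  then have "fact n * kummer_coeff p q n = Gamma (p + real n) / Gamma p / (Gamma (q + real n) / Gamma q)"
    by (simp add: kummer_coeff_def pochhammer_Gamma)
  moreover have "Gamma p > 0" "Gamma q > 0" using assms by (simp_all add: Gamma_real_pos)
  moreover have "q - p + (real n + p) = q + real n" by simp
  ultimately show ?thesis
    by (simp add: Beta_def field_simps)
qed

text \<open>Substitution \<open>t = z * v\<close> in Euler's integral for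
  \<open>Gamma s\<close>.\<close>

lemma integral_powr_exp:
  fixes s z :: real
  assumes "0 < s" "0 < z"
  shows "((\<lambda>v. v powr (s - 1) * exp (- z * v)) has_integral Gamma s * z powr (- s)) {0..}"
proof -
  let ?f = "\<lambda>t. t powr (s - 1) / exp t"
  have f: "(?f has_integral Gamma s) {0..}" by (rule Gamma_integral_real[OF assms(1)])
  have img: "(\<lambda>v. z * v) ` {0..} = {0..}"
    using assms by (auto simp: image_iff intro!: bexI[of _ "_ / z"])
  have "(\<lambda>v. \<bar>z\<bar> * ?f (z * v)) absolutely_integrable_on {0..}
      \<and> integral {0..} (\<lambda>v. \<bar>z\<bar> * ?f (z * v)) = Gamma s
    \<longleftrightarrow> ?f absolutely_integrable_on ((\<lambda>v. z * v) ` {0..}) \<and> integral ((\<lambda>v. z * v) ` {0..}) ?f = Gamma s"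
    by (rule has_absolute_integral_change_of_variables_1')
       (use assms in \<open>auto intro!: derivative_eq_intros inj_onI\<close>)
  moreover have "?f absolutely_integrable_on {0..}"
    using f by (intro nonnegative_absolutely_integrable_1) (auto simp: has_integral_integrable)
  ultimately have "((\<lambda>v. z * ?f (z * v)) has_integral Gamma s) {0..}"
    using assms f unfolding img
    by (simp add: has_integral_iff set_lebesgue_integral_eq_integral(1))
  from has_integral_mult_right[OF this, of "z powr (- s)"]
  have "((\<lambda>v. z powr (- s) * (z * ?f (z * v))) has_integral Gamma s * z powr (- s)) {0..}"
    by (simp add: mult.commute)
  moreover have "z powr (- s) * (z * ?f (z * v)) = v powr (s - 1) * exp (- z * v)" if "v \<in> {0..}" for v
  proof -
    have "z powr (- s) * (z * z powr (s - 1)) = 1"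
      using assms powr_add[of z "- s" "1 + (s - 1)"] powr_add[of z 1 "s - 1"] by simp
    then show ?thesis
      using that assms by (simp add: powr_mult exp_minus divide_inverse)
  qed
  ultimately show ?thesis by (metis (no_types, lifting) has_integral_cong)
qed

text \<open>Each partial sum of the Kummer series is a Beta integral whose integrand is dominated by that of
  the Gamma integral.\<close>

lemma kummer_exp_le:
  assumes "1 \<le> p" "p < q" "0 < z"
  shows "kummer_exp p q z \<le> Gamma q / Gamma p * z powr (p - q)"
proof -
  define K where "K = Gamma p * Gamma (q - p) / Gamma q"
  have G: "Gamma p > 0" "Gamma q > 0" "Gamma (q - p) > 0"
    using assms by (simp_all add: Gamma_real_pos)
  have part: "K * (\<Sum>n<N. kummer_coeff p q n * z ^ n) \<le> exp z * (Gamma (q - p) * z powr (p - q))" for N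
  proof -
    define h where "h v = (\<Sum>n<N. z ^ n / fact n * (v powr (q - p - 1) * (1 - v) powr (real n + p - 1)))" for v
    have "(h has_integral (\<Sum>n<N. z ^ n / fact n * (K * (fact n * kummer_coeff p q n)))) {0..1}"
      unfolding h_def K_def
      by (intro has_integral_sum has_integral_mult_right kummer_coeff_beta) (use assms in auto)
    moreover have "(\<Sum>n<N. z ^ n / fact n * (K * (fact n * kummer_coeff p q n)))
        = K * (\<Sum>n<N. kummer_coeff p q n * z ^ n)"
      unfolding sum_distrib_left by (rule sum.cong) auto
    \<comment> \<open>Extension by zero lets both integrals run over the half-line.\<close>
    ultimately have "((\<lambda>v. if v \<in> {0..1} then h v else 0) has_integral K * (\<Sum>n<N. kummer_coeff p q n * z ^ n)) {0..}"
      by (subst has_integral_restrict) auto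
    moreover have "((\<lambda>v. exp z * (v powr (q - p - 1) * exp (- z * v))) has_integral
        exp z * (Gamma (q - p) * z powr (p - q))) {0..}"
      using has_integral_mult_right[OF integral_powr_exp[of "q - p" z], of "exp z"] assms by simp
    ultimately show ?thesis
    proof (rule has_integral_le)
      fix v :: real assume "v \<in> {0..}"
      then have v: "0 \<le> v" by simp
      show "(if v \<in> {0..1} then h v else 0) \<le> exp z * (v powr (q - p - 1) * exp (- z * v))"
      proof (cases "v \<in> {0..1}")
        case True
        have "h v \<le> (\<Sum>n<N. v powr (q - p - 1) * ((z * (1 - v)) ^ n / fact n))"
          unfolding h_def
        proof (rule sum_mono)
          fix n
          \<comment> \<open>As \<open>1 \<le> p\<close>, the exponent is at least \<open>n\<close>,
            on a base in the unit interval.\<close>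
          have "(1 - v) powr (real n + p - 1) \<le> (1 - v) ^ n"
          proof (cases "v = 1")
            case True
            then show ?thesis by simp
          next
            case False
            then have "(1 - v) powr (real n + p - 1) \<le> (1 - v) powr (real n)"
              using \<open>v \<in> {0..1}\<close> assms by (intro powr_mono') auto
            then show ?thesis using False \<open>v \<in> {0..1}\<close> by (simp add: powr_realpow)
          qed
          from mult_left_mono[OF this, of "v powr (q - p - 1) * z ^ n / fact n"]
          show "z ^ n / fact n * (v powr (q - p - 1) * (1 - v) powr (real n + p - 1))
              \<le> v powr (q - p - 1) * ((z * (1 - v)) ^ n / fact n)"
            using assms by (simp add: power_mult_distrib ac_simps)
        qed
        also have "\<dots> = v powr (q - p - 1) * (\<Sum>n<N. (z * (1 - v)) ^ n / fact n)"
          by (simp add: sum_distrib_left)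
        also have "(\<Sum>n<N. (z * (1 - v)) ^ n / fact n) \<le> exp (z * (1 - v))"
        proof -
          have "(\<lambda>n. (z * (1 - v)) ^ n / fact n) sums exp (z * (1 - v))"
            using exp_converges[of "z * (1 - v)"] by (simp add: scaleR_conv_of_real divide_inverse mult.commute)
          then show ?thesis
            using True assms by (simp add: sums_iff) (metis (no_types, lifting) sum_le_suminf finite_lessThan
              zero_le_divide_iff zero_le_power fact_ge_zero mult_nonneg_nonneg diff_ge_0_iff_ge less_imp_le)
        qed
        also have "exp (z * (1 - v)) = exp z * exp (- z * v)"
          by (simp add: exp_add[symmetric] algebra_simps)
        finally have "h v \<le> v powr (q - p - 1) * (exp z * exp (- z * v))" by (simp add: mult_left_mono)
        then show ?thesis using True by (simp add: ac_simps)
      qed (use v in auto)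
    qed
  qed
  have "K * kummer p q z \<le> exp z * (Gamma (q - p) * z powr (p - q))"
  proof (rule LIMSEQ_le_const2)
    show "(\<lambda>N. K * (\<Sum>n<N. kummer_coeff p q n * z ^ n)) \<longlonglongrightarrow> K * kummer p q z"
      unfolding kummer_def by (intro tendsto_mult_left summable_LIMSEQ summable_kummer) (use assms in auto)
  qed (use part in auto)
  then show ?thesis
    using G unfolding K_def kummer_exp_def by (simp add: exp_minus field_simps)
qed

section \<open>Log-convexity and geometric concavity\<close>

lemma Phi_eq:
  assumes "-1/2 \<le> nu" "0 < x" "a = nu + 1/2"
  shows "Phi nu x = 2 powr (- nu) / Gamma (nu + 1) * kummer_exp (a + 1) (2 * a + 1) (2 * x)"
proof -
  have e: "a + 1 = nu + 3/2" "2 * a + 1 = 2 * nu + 2" using assms by simp_all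
  show ?thesis unfolding e by (rule Phi_eq_kummer_exp[OF assms(1,2)])
qed

lemma Phi_pos:
  assumes "-1/2 \<le> nu" "0 < x"
  shows "0 < Phi nu x"
  using assms Phi_eq_kummer_exp[OF assms] kummer_exp_pos[of "nu + 3/2" "2 * nu + 2" "2 * x"]
  by (simp add: Gamma_real_pos)

lemma DERIV_ln_Phi:
  assumes "-1/2 \<le> nu" "0 < x"
  shows "((\<lambda>x. ln (Phi nu x)) has_real_derivative - 2 * kummer_ratio (nu + 1/2) (2 * x)) (at x)"
proof -
  define a where "a = nu + 1/2"
  let ?k = "kummer_exp (a + 1) (2 * a + 1)"
  let ?C = "2 powr (- nu) / Gamma (nu + 1)"
  have C: "?C > 0" using assms by (simp add: Gamma_real_pos)
  have "((\<lambda>x. ln ?C + ln (?k (2 * x))) has_real_derivative 0 + - kummer_ratio a (2 * x) * 2) (at x)"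
    by (intro DERIV_add DERIV_const DERIV_chain2[OF DERIV_ln_kummer_exp])
       (use assms in \<open>auto simp: a_def intro!: derivative_eq_intros\<close>)
  then have "((\<lambda>x. ln (Phi nu x)) has_real_derivative 0 + - kummer_ratio a (2 * x) * 2) (at x)"
  proof (rule has_field_derivative_transform_within_open[of _ _ _ "{0<..}"])
    fix x :: real assume "x \<in> {0<..}"
    then have x: "0 < x" and k: "0 < ?k (2 * x)"
      using assms by (auto simp: a_def intro!: kummer_exp_pos)
    show "ln ?C + ln (?k (2 * x)) = ln (Phi nu x)"
      unfolding Phi_eq[OF assms(1) x a_def] by (rule ln_mult_pos[OF C k, symmetric])
  qed (use assms in auto)
  then show ?thesis by (simp add: a_def mult.commute)
qed

lemma log_convex_on_Phi:
  assumes "-1/2 \<le> nu"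
  shows "log_convex_on {0<..} (Phi nu)"
  unfolding log_convex_on_def
proof (intro conjI ballI)
  show "convex_on {0<..} (\<lambda>x. ln (Phi nu x))"
  proof (rule convex_on_realI)
    show "((\<lambda>x. ln (Phi nu x)) has_real_derivative - 2 * kummer_ratio (nu + 1/2) (2 * x)) (at x)"
      if "x \<in> {0<..}" for x
      using that assms by (intro DERIV_ln_Phi) auto
  qed (use assms in \<open>auto intro!: kummer_ratio_antimono\<close>)
qed (use assms Phi_pos in auto)

text \<open>In the variable \<open>t = ln x\<close>, minus the logarithm of \<open>Phi\<close> has
  derivative \<open>y * kummer_ratio a y\<close> with \<open>y = 2 * exp t\<close>, which is
  nondecreasing.\<close>

lemma geom_concave_on_Phi:
  assumes "-1/2 \<le> nu"
  shows "geom_concave_on {0<..} (Phi nu)"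
  unfolding geom_concave_on_def
proof (intro conjI ballI)
  have "convex_on UNIV (\<lambda>t. - ln (Phi nu (exp t)))"
  proof (rule convex_on_realI)
    show "((\<lambda>t. - ln (Phi nu (exp t))) has_real_derivative
        - (- 2 * kummer_ratio (nu + 1/2) (2 * exp t) * exp t)) (at t)" for t
      by (intro DERIV_minus DERIV_chain2[OF DERIV_ln_Phi] DERIV_exp assms) simp
    show "- (- 2 * kummer_ratio (nu + 1/2) (2 * exp s) * exp s)
        \<le> - (- 2 * kummer_ratio (nu + 1/2) (2 * exp t) * exp t)" if "s \<le> t" for s t
      using mult_kummer_ratio_mono[of "nu + 1/2" "2 * exp s" "2 * exp t"] that assms
      by (simp add: mult_ac)
  qed simp
  then have conc: "u * ln (Phi nu (exp s)) + (1 - u) * ln (Phi nu (exp t)) \<le> ln (Phi nu (exp (u * s + (1 - u) * t)))"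
    if "0 \<le> u" "u \<le> 1" for s t u
    using convex_onD[of UNIV "\<lambda>t. - ln (Phi nu (exp t))" u t s] that
    by (simp add: algebra_simps)
  fix x y l :: real assume xy: "x \<in> {0<..}" "y \<in> {0<..}" and l: "l \<in> {0..1}"
  have "x powr l * y powr (1 - l) = exp (l * ln x + (1 - l) * ln y)"
    using xy by (simp add: powr_def exp_add)
  moreover have "Phi nu x powr l * Phi nu y powr (1 - l) = exp (l * ln (Phi nu x) + (1 - l) * ln (Phi nu y))"
    using Phi_pos[OF assms, of x] Phi_pos[OF assms, of y] xy by (simp add: powr_def exp_add)
  moreover have "exp (l * ln (Phi nu x) + (1 - l) * ln (Phi nu y)) \<le> exp (ln (Phi nu (exp (l * ln x + (1 - l) * ln y))))"
    unfolding exp_le_cancel_iff using conc[of l "ln x" "ln y"] l xy by simp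
  ultimately show "Phi nu x powr l * Phi nu y powr (1 - l) \<le> Phi nu (x powr l * y powr (1 - l))"
    using Phi_pos[OF assms, of "x powr l * y powr (1 - l)"] by (simp only: exp_ln exp_gt_zero)
qed (use assms Phi_pos in auto)

section \<open>Monotonicity in the order\<close>

text \<open>The reciprocal of this product is the part of \<open>bessel_coeff\<close> that depends
  on the order. Its logarithmic derivative is \<open>ln 2 + Digamma (t + k)\<close>.\<close>

lemma powr_mult_Gamma_mono:
  fixes mu nu k :: real
  assumes "0 \<le> mu" "mu \<le> nu" "1 \<le> k"
  shows "2 powr mu * Gamma (mu + k) \<le> 2 powr nu * Gamma (nu + k)"
proof (rule DERIV_nonneg_imp_nondecreasing[OF assms(2)])
  fix t assume "mu \<le> t" "t \<le> nu"
  then have t: "1 \<le> t + k" using assms by simp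
  have "t + k \<notin> \<int>\<^sub>\<le>\<^sub>0" using t by (auto dest: nonpos_Ints_nonpos)
  then have "((\<lambda>t. 2 powr t * Gamma (t + k)) has_real_derivative
      2 powr t * Gamma (t + k) * (ln 2 + Digamma (t + k))) (at t)"
    by (auto intro!: derivative_eq_intros simp: algebra_simps)
  moreover have "Digamma 1 \<le> Digamma (t + k)"
    using t by (intro Digamma_real_mono) auto
  \<comment> \<open>\<open>Digamma 1\<close> is minus Euler's constant, which is below
    \<open>13/22 < 2/3 \<le> ln 2\<close>.\<close>
  then have "0 \<le> ln 2 + Digamma (t + k)"
    using ln2_ge_two_thirds euler_mascheroni_less_13_over_22 by simp
  moreover have "0 < Gamma (t + k)" using t by (simp add: Gamma_real_pos)
  ultimately show "\<exists>D. ((\<lambda>t. 2 powr t * Gamma (t + k)) has_real_derivative D) (at t) \<and> 0 \<le> D"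
    by (intro exI[of _ "2 powr t * Gamma (t + k) * (ln 2 + Digamma (t + k))"] conjI) simp_all
qed

lemma Phi_antimono_order:
  assumes "0 \<le> mu" "mu \<le> nu" "0 < x"
  shows "Phi nu x \<le> Phi mu x"
proof -
  have eq: "Phi r x = exp (- x) * (\<Sum>n. bessel_coeff r n * x ^ n)" if "0 \<le> r" for r
    using besselI_add_besselI[of r x] that assms by (simp add: Phi_def mult.assoc)
  have "bessel_coeff nu n \<le> bessel_coeff mu n" for n
  proof -
    let ?k = "real (n - n div 2) + 1"
    have eq': "bessel_coeff r n = inverse (2 powr r * Gamma (r + ?k)) / (2 ^ n * fact (n div 2))" for r
      by (simp add: bessel_coeff_def rGamma_inverse_Gamma powr_minus add_ac)
    have "0 < Gamma (mu + ?k)" using assms by (simp add: Gamma_real_pos)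
    moreover have "2 powr mu * Gamma (mu + ?k) \<le> 2 powr nu * Gamma (nu + ?k)"
      using assms by (intro powr_mult_Gamma_mono) auto
    ultimately show ?thesis unfolding eq'
      by (intro divide_right_mono le_imp_inverse_le) auto
  qed
  then have "(\<Sum>n. bessel_coeff nu n * x ^ n) \<le> (\<Sum>n. bessel_coeff mu n * x ^ n)"
    using assms by (intro suminf_le summable_bessel_coeff mult_right_mono) auto
  then show ?thesis using assms by (simp add: eq)
qed

section \<open>Weighted monotonicity and the lower bound\<close>

lemma weighted_Phi_eq:
  assumes "-1/2 \<le> nu" "0 < x" "a = nu + 1/2"
  shows "(x + a / 2) powr a * Phi nu x
       = 2 powr (- a) * (2 powr (- nu) / Gamma (nu + 1)) * weighted_kummer_exp a (2 * x)"
proof -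
  have "(2 * x + a) powr a = 2 powr a * (x + a / 2) powr a"
  proof -
    have "2 * x + a = 2 * (x + a / 2)" by simp
    then show ?thesis using assms by (simp only: powr_mult)
  qed
  moreover have "2 powr (- a) * 2 powr a = (1::real)" by (simp add: powr_minus)
  ultimately have "2 powr (- a) * (2 * x + a) powr a = (x + a / 2) powr a"
    by (metis mult.assoc mult_1)
  then show ?thesis
    unfolding Phi_eq[OF assms] weighted_kummer_exp_def by (simp add: ac_simps)
qed

lemma weighted_Phi_mono:
  assumes "-1/2 \<le> nu" "0 < x" "x \<le> y" "a = nu + 1/2"
  shows "(x + a / 2) powr a * Phi nu x \<le> (y + a / 2) powr a * Phi nu y"
proof -
  have "weighted_kummer_exp a (2 * x) \<le> weighted_kummer_exp a (2 * y)"
    using assms by (intro weighted_kummer_exp_mono) auto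
  then show ?thesis
    using assms by (simp add: weighted_Phi_eq Gamma_real_pos divide_right_mono)
qed

lemma shift_quotient_mono:
  fixes x y s b :: real
  assumes "s \<le> b" "0 < x + b" "x \<le> y"
  shows "(x + s) / (x + b) \<le> (y + s) / (y + b)"
proof -
  have "(z + s) / (z + b) = 1 - (b - s) / (z + b)" if "0 < z + b" for z
    using that by (simp add: divide_simps)
  moreover have "(b - s) / (y + b) \<le> (b - s) / (x + b)"
    using assms by (intro divide_left_mono) auto
  ultimately show ?thesis using assms by simp
qed

text \<open>The shift \<open>a / 2\<close> is the strongest case: a smaller shift \<open>s\<close>
  multiplies it by the nondecreasing factor \<open>((x + s) / (x + a / 2)) powr a\<close>.\<close>

lemma shifted_weighted_Phi_mono:
  assumes "-1/2 \<le> nu" "0 < x" "x \<le> y" "a = nu + 1/2" "s \<le> a / 2" "0 < x + s"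
  shows "(x + s) powr a * Phi nu x \<le> (y + s) powr a * Phi nu y"
proof -
  let ?q = "\<lambda>x. ((x + s) / (x + a / 2)) powr a"
  have eq: "(z + s) powr a * Phi nu z = ?q z * ((z + a / 2) powr a * Phi nu z)" if "x \<le> z" for z
  proof -
    have "0 < z + s" "0 < z + a / 2" using assms that by linarith+
    then show ?thesis by (simp add: powr_divide)
  qed
  have "(x + s) / (x + a / 2) \<le> (y + s) / (y + a / 2)"
    by (rule shift_quotient_mono) (use assms in linarith)+
  moreover have "0 \<le> a" "0 \<le> (x + s) / (x + a / 2)" using assms by simp_all
  ultimately have "?q x \<le> ?q y" by (intro powr_mono2)
  then have "?q x * ((x + a / 2) powr a * Phi nu x) \<le> ?q y * ((y + a / 2) powr a * Phi nu y)"
    using assms Phi_pos[of nu x] by (intro mult_mono weighted_Phi_mono) auto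
  then show ?thesis unfolding eq[OF order_refl] eq[OF assms(3)] .
qed

text \<open>The left side is the value at \<open>0\<close>, where
  \<open>weighted_kummer_exp a\<close> equals \<open>a powr a\<close>.\<close>

lemma Phi_lower_bound:
  assumes "-1/2 < nu" "0 < x" "a = nu + 1/2"
  shows "2 powr (- a) * (2 powr (- nu) / Gamma (nu + 1)) * a powr a < (x + a / 2) powr a * Phi nu x"
proof -
  have "weighted_kummer_exp a 0 < weighted_kummer_exp a (2 * x)"
    using assms by (intro weighted_kummer_exp_strict_mono) auto
  then show ?thesis
    using assms by (simp add: weighted_Phi_eq weighted_kummer_exp_def kummer_exp_def Gamma_real_pos divide_strict_right_mono)
qed

section \<open>The upper bound\<close>

lemma Gamma_real_legendre_duplication:
  fixes z :: real
  assumes "0 < z"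
  shows "Gamma z * Gamma (z + 1/2) = 2 powr (1 - 2 * z) * sqrt pi * Gamma (2 * z)"
proof -
  have "complex_of_real z \<notin> \<int>\<^sub>\<le>\<^sub>0" "complex_of_real z + 1/2 \<notin> \<int>\<^sub>\<le>\<^sub>0"
    using assms
    by (auto simp: complex_nonpos_Reals_iff dest!: subsetD[OF nonpos_Ints_subset_nonpos_Reals])
  from Gamma_legendre_duplication[OF this]
  have "complex_of_real (Gamma z * Gamma (z + 1/2))
      = complex_of_real (exp ((1 - 2 * z) * ln 2) * sqrt pi * Gamma (2 * z))"
    by (simp flip: Gamma_complex_of_real exp_of_real)
  then show ?thesis
    unfolding of_real_eq_iff by (simp add: powr_def)
qed

text \<open>At \<open>p = a + 1\<close>, \<open>q = 2 * a + 1\<close> the decay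
  \<open>z powr (p - q)\<close> cancels \<open>x powr a\<close> up to a constant, and the
  duplication formula at \<open>a + 1/2\<close> evaluates the Gamma quotient.\<close>

lemma powr_mult_Phi_le:
  assumes "-1/2 < nu" "0 < x" "a = nu + 1/2"
  shows "x powr a * Phi nu x \<le> sqrt (2 / pi)"
proof -
  let ?C = "2 powr (- nu) / Gamma (nu + 1)"
  have nu: "nu = a - 1/2" and a: "0 < a" using assms by simp_all
  have G: "Gamma (a + 1) > 0" "Gamma (a + 1/2) > 0" using a by (simp_all add: Gamma_real_pos)
  have dup: "Gamma (a + 1/2) * Gamma (a + 1) = 2 powr (- 2 * a) * sqrt pi * Gamma (2 * a + 1)"
    using Gamma_real_legendre_duplication[of "a + 1/2"] a by (simp add: distrib_left add.commute)
  have "x powr a * Phi nu x \<le> x powr a * (?C * (Gamma (2 * a + 1) / Gamma (a + 1) * (2 * x) powr (- a)))"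
  proof -
    have "kummer_exp (a + 1) (2 * a + 1) (2 * x) \<le> Gamma (2 * a + 1) / Gamma (a + 1) * (2 * x) powr (- a)"
      using kummer_exp_le[of "a + 1" "2 * a + 1" "2 * x"] assms(2) a by simp
    moreover have "0 \<le> ?C" using Gamma_real_pos[of "nu + 1"] assms by simp
    ultimately show ?thesis
      unfolding Phi_eq[OF less_imp_le[OF assms(1)] assms(2,3)] by (intro mult_left_mono) auto
  qed
  also have "\<dots> = 2 powr (- nu) * 2 powr (- a) * Gamma (2 * a + 1) / (Gamma (a + 1/2) * Gamma (a + 1))"
  proof -
    have "(2 * x) powr (- a) = 2 powr (- a) / x powr a" "0 < x powr a"
      using powr_mult[of 2 x "- a"] assms(2) by (simp_all add: powr_minus divide_inverse)
    moreover have "nu + 1 = a + 1/2" using nu by simp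
    ultimately show ?thesis by simp
  qed
  also have "\<dots> = 2 powr (- nu) * 2 powr (- a) / (2 powr (- 2 * a) * sqrt pi)"
    unfolding dup using a less_imp_neq[OF Gamma_real_pos[of "2 * a + 1"]] by simp
  \<comment> \<open>Since \<open>nu = a - 1/2\<close>, a factor \<open>sqrt 2\<close> is left
    over.\<close>
  also have "2 powr (- nu) * 2 powr (- a) = 2 powr (- 2 * a) * 2 powr (1/2)"
    unfolding nu powr_add[symmetric] by simp
  also have "2 powr (- 2 * a) * 2 powr (1/2) / (2 powr (- 2 * a) * sqrt pi) = sqrt (2 / pi)"
    by (simp add: powr_half_sqrt real_sqrt_divide)
  finally show ?thesis .
qed

text \<open>The bound at \<open>x + 1\<close> comes from letting \<open>y\<close> tend to infinity,
  where the weights \<open>(y + a / 2) powr a\<close> and \<open>y powr a\<close> have quotient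
  tending to 1. The step from \<open>x\<close> to \<open>x + 1\<close> supplies the strictness lost
  in the limit.\<close>

lemma Phi_upper_bound:
  assumes "-1/2 < nu" "0 < x" "a = nu + 1/2"
  shows "(x + a / 2) powr a * Phi nu x < sqrt (2 / pi)"
proof -
  have a: "0 < a" using assms by simp
  have "weighted_kummer_exp a (2 * x) < weighted_kummer_exp a (2 * (x + 1))"
    using assms by (intro weighted_kummer_exp_strict_mono) auto
  then have "(x + a / 2) powr a * Phi nu x < (x + 1 + a / 2) powr a * Phi nu (x + 1)"
    using assms weighted_Phi_eq[of nu x a] weighted_Phi_eq[of nu "x + 1" a]
    by (simp add: Gamma_real_pos divide_strict_right_mono)
  also have "\<dots> \<le> sqrt (2 / pi)"
  proof (rule tendsto_lowerbound)
    have "((\<lambda>y. (1 + a / 2 / y) powr a * sqrt (2 / pi)) \<longlongrightarrow> (1 + 0) powr a * sqrt (2 / pi)) at_top"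
      by (intro tendsto_intros real_tendsto_divide_at_top[OF tendsto_const] filterlim_ident) simp
    then show "((\<lambda>y. (1 + a / 2 / y) powr a * sqrt (2 / pi)) \<longlongrightarrow> sqrt (2 / pi)) at_top"
      by simp
    show "\<forall>\<^sub>F y in at_top. (x + 1 + a / 2) powr a * Phi nu (x + 1) \<le> (1 + a / 2 / y) powr a * sqrt (2 / pi)"
      using eventually_ge_at_top[of "x + 1"]
    proof eventually_elim
      case (elim y)
      then have y: "0 < y" using assms by simp
      have "(x + 1 + a / 2) powr a * Phi nu (x + 1) \<le> (y + a / 2) powr a * Phi nu y"
        using assms elim by (intro weighted_Phi_mono) auto
      also have "y + a / 2 = (1 + a / 2 / y) * y" using y by (simp add: field_simps)
      also have "((1 + a / 2 / y) * y) powr a * Phi nu y = (1 + a / 2 / y) powr a * (y powr a * Phi nu y)"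
        using y a by (simp add: powr_mult)
      also have "\<dots> \<le> (1 + a / 2 / y) powr a * sqrt (2 / pi)"
        using powr_mult_Phi_le[OF assms(1) y assms(3)] by (intro mult_left_mono) auto
      finally show ?case .
    qed
  qed simp
  finally show ?thesis .
qed

text \<open>In claim (e) the domain keeps the base \<open>x + nu/2\<close> of the real power
  positive, which restricts \<open>x\<close> only for negative \<open>nu\<close>.\<close>

theorem theorem1:
  shows
  "(\<forall>nu::real. nu \<ge> -1/2 \<longrightarrow> completely_monotonic (Phi nu))
   \<and> (\<forall>nu::real. nu \<ge> -1/2 \<longrightarrow>
        log_convex_on {0<..} (Phi nu) \<and> geom_concave_on {0<..} (Phi nu))
   \<and> (\<forall>x::real. x > 0 \<longrightarrow> antimono_on {0..} (\<lambda>nu. Phi nu x))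
   \<and> (\<forall>nu::real. nu \<ge> -1/2 \<longrightarrow>
        mono_on {0<..} (\<lambda>x. x powr (nu + 1/2) * Phi nu x))
   \<and> (\<forall>nu::real. nu \<ge> -1/2 \<longrightarrow>
        mono_on {x. x > 0 \<and> x + nu/2 > 0} (\<lambda>x. (x + nu/2) powr (nu + 1/2) * Phi nu x))
   \<and> (\<forall>nu::real. nu \<ge> -1/2 \<longrightarrow>
        mono_on {0<..} (\<lambda>x. (x + nu/2 + 1/4) powr (nu + 1/2) * Phi nu x))
   \<and> (\<forall>nu x::real. nu > -1/2 \<longrightarrow> x > 0 \<longrightarrow>
        (nu + 1/2) powr (nu + 1/2)
          / (2 powr (2*nu + 1/2) * Gamma (nu + 1) * (x + nu/2 + 1/4) powr (nu + 1/2))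
          < Phi nu x
        \<and> Phi nu x < sqrt (2 / pi) * (1 / (x + nu/2 + 1/4) powr (nu + 1/2)))"
proof (intro conjI allI impI)
  fix nu :: real assume nu: "-1/2 \<le> nu"
  show "completely_monotonic (Phi nu)"
    using nu by (intro completely_monotonic_kummer_exp[OF _ _ Phi_eq_kummer_exp]) (auto simp: Gamma_real_pos)
  show "log_convex_on {0<..} (Phi nu)" by (rule log_convex_on_Phi[OF nu])
  show "geom_concave_on {0<..} (Phi nu)" by (rule geom_concave_on_Phi[OF nu])
  \<comment> \<open>Claims (d), (e), (f) take the shifts \<open>0\<close>, \<open>nu/2\<close> and
    the largest one, \<open>a / 2 = nu/2 + 1/4\<close>.\<close>
  note mono = shifted_weighted_Phi_mono[OF nu _ _ refl]
  show "mono_on {0<..} (\<lambda>x. x powr (nu + 1/2) * Phi nu x)"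
    using mono[where s = 0] nu by (auto intro!: mono_onI)
  show "mono_on {x. x > 0 \<and> x + nu/2 > 0} (\<lambda>x. (x + nu/2) powr (nu + 1/2) * Phi nu x)"
    using mono[where s = "nu/2"] by (auto intro!: mono_onI)
  show "mono_on {0<..} (\<lambda>x. (x + nu/2 + 1/4) powr (nu + 1/2) * Phi nu x)"
    using mono[where s = "nu/2 + 1/4"] nu by (auto intro!: mono_onI simp: add.assoc)
next
  fix x :: real assume "0 < x"
  then show "antimono_on {0..} (\<lambda>nu. Phi nu x)"
    by (intro monotone_onI Phi_antimono_order) auto
next
  fix nu x :: real assume nu: "-1/2 < nu" and x: "0 < x"
  define a where "a = nu + 1/2"
  have shift: "x + nu/2 + 1/4 = x + a / 2" by (simp add: a_def)
  have pos: "0 < (x + a / 2) powr a"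
  proof -
    have "0 < a" using nu by (simp add: a_def)
    then have "0 < x + a / 2" using x by simp
    then show ?thesis by simp
  qed
  \<comment> \<open>The exponent splits as \<open>a + nu\<close>, matching the constants of
    \<open>Phi_lower_bound\<close>.\<close>
  have p: "2 powr (2 * nu + 1/2) = 2 powr a * 2 powr nu"
    unfolding powr_add[symmetric] by (simp add: a_def)
  have "a powr a / (2 powr (2 * nu + 1/2) * Gamma (nu + 1)) = 2 powr (- a) * (2 powr (- nu) / Gamma (nu + 1)) * a powr a"
    unfolding p unfolding powr_minus divide_inverse inverse_mult_distrib by (simp only: ac_simps)
  also have "\<dots> < (x + a / 2) powr a * Phi nu x"
    by (rule Phi_lower_bound[OF nu x a_def])
  finally have "a powr a / (2 powr (2 * nu + 1/2) * Gamma (nu + 1)) / (x + a / 2) powr a < Phi nu x"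
    unfolding pos_divide_less_eq[OF pos] by (simp only: mult.commute)
  then show "(nu + 1/2) powr (nu + 1/2)
      / (2 powr (2*nu + 1/2) * Gamma (nu + 1) * (x + nu/2 + 1/4) powr (nu + 1/2)) < Phi nu x"
    unfolding shift a_def[symmetric] by simp
  show "Phi nu x < sqrt (2 / pi) * (1 / (x + nu/2 + 1/4) powr (nu + 1/2))"
    using Phi_upper_bound[OF nu x a_def] pos unfolding shift a_def[symmetric]
    by (simp only: pos_less_divide_eq times_divide_eq_right mult_1_right mult.commute)
qed

end
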